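(* Suppose that the system $dx_t=P(x_t)\,dt+\sigma\,dB_t$, $x_0=0$, is noise propagating. For $\epsilon\in(0,e^{-1})$ let $x_{\epsilon,t}=(x^1_{\epsilon,t},\dots,x^n_{\epsilon,t})$ with $x^j_{\epsilon,t}=x^j_{\epsilon t}/\epsilon^{\mathfrak a_j}$, and let $B_{\epsilon,t}=B_{\epsilon t}/\sqrt\epsilon$. Then for all $t<\tau_\infty/\epsilon$, $x_{\epsilon,t}$ solves an SDE of the form $$dx_{\epsilon,t}=[P_{\mathrm L}(x_{\epsilon,t})+R_{\epsilon,\mathrm L}(x_{\epsilon,t})]\,dt+\frac{\sigma\,dB_{\epsilon,t}}{\epsilon^{(0,1/2)}},$$ where $R_{\epsilon,\mathrm L}$ is a polynomial vector field on $\mathbf R^n$ such that for all $C>0$, $\sup_{|x|\le C}|R_{\epsilon,\mathrm L}(x)|\to0$ as $\epsilon\to0^+$.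
   Context: Setting. $n\ge1$, $I=\{1,\dots,n\}$, $P=(P^1,\dots,P^n):\mathbf R^n\to\mathbf R^n$ is a polynomial vector field, $\sigma=\mathrm{diag}(\sigma^1,\dots,\sigma^n)$ with constants $\sigma^i\ge0$ (some may vanish), $B_t$ is a standard $n$-dimensional Brownian motion on a filtered probability space $(\Omega,\mathcal F,(\mathcal F_t)_{t\ge 0},\mathbf P)$, and $x_t$ is the unique pathwise solution of $dx_t=P(x_t)\,dt+\sigma\,dB_t$, $x_0=0$, defined up to its explosion time $\tau_\infty=\lim_k\inf\{t\ge0:|x_t|\ge k\}$. Scalings. $\mathcal S=\tfrac12\mathbf Z_{\ge0}\times\tfrac12\mathbf Z_{\ge0}$. For $a=(a^1,a^2),b=(b^1,b^2)\in\mathcal S$, $a\preceq b$ iff $a^1<b^1$, or $a^1=b^1$ and $a^2\ge b^2$; $a\prec b$ iff $a\preceq b$ and $a\ne b$. $\mathcal S_\infty=\mathcal S\cup\{\infty\}$ with $b\prec\infty$ for all $b\in\mathcal S$. Addition is componentwise in $\mathcal S$, and any sum involving $\infty$ is $\infty$; for $\ell\in\mathbf Z_{\ge0}$, $\ell a$ is componentwise for $a\in\mathcal S$, $\ell\infty=\infty$ if $\ell\ge1$, and $0\cdot\infty=(0,0)$. $\mathrm{proj}_1$ is the first coordinate, $\mathrm{proj}_1\infty=\infty$. For a monomial $m(x)=\alpha(x^1)^{n_1}\cdots(x^n)^{n_n}$, $\alpha\neq0$, and $a_1,\dots,a_n\in\mathcal S_\infty$, $m(a_1,\dots,a_n)=n_1a_1+\cdots+n_na_n$;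 the zero polynomial has value $\infty$. For a nonzero polynomial $p$ written in standard form (as a sum of a minimal number of monomials), $p(a_1,\dots,a_n)$ is the $\preceq$-minimum of the values of its monomials. For $\epsilon\in(0,e^{-1})$ and $a\in\mathcal S$, $\epsilon^a:=\epsilon^{a^1}(\log\log\epsilon^{-1})^{a^2}$. Inductive procedure. $I_0=\{j\in I:\sigma^j>0\}$; $a_{0,j}=(1/2,1/2)$ and $P^j_{\mathrm L}\equiv0$ for $j\in I_0$; $a_{0,j}=\infty$ for $j\notin I_0$. For $\ell\ge0$: if $I\setminus\bigcup_{k=0}^\ell I_k=\emptyset$ or $P^j(a_{\ell,1},\dots,a_{\ell,n})=\infty$ for all $j\in I\setminus\bigcup_{k=0}^\ell I_k$, stop and set $I_i=\emptyset$ for $i\ge\ell+1$. Otherwise let $m_{\ell+1}=\min\{\mathrm{proj}_1P^j(a_{\ell,1},\dots,a_{\ell,n}):j\in I\setminus\bigcup_{k=0}^\ell I_k\}$ and $I_{\ell+1}=\{j\in I\setminus\bigcup_{k=0}^\ell I_k:\mathrm{proj}_1P^j(a_{\ell,1},\dots,a_{\ell,n})=m_{\ell+1}\}$; set $a_{\ell+1,j}=P^j(a_{\ell,1},\dots,a_{\ell,n})+(1,0)$ for $j\in I_{\ell+1}$ and $a_{\ell+1,j}=a_{\ell,j}$ otherwise; for $j\in I_{\ell+1}$ let $P^j_{\mathrm L}$ be the sum of those monomials $m$ in the standard form of $P^j$ with $m(a_{\ell,1},\dots,a_{\ell,n})=P^j(a_{\ell,1},\dots,a_{\ell,n})$. The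 system is noise propagating if $\bigcup_{k=0}^\ell I_k=I$ for some $\ell\ge0$; with $\dim$ the smallest such $\ell$, $\mathfrak a_j:=a_{\dim,j}\in\mathcal S$. $P_{\mathrm L}=(P^1_{\mathrm L},\dots,P^n_{\mathrm L})$. *)

theory Defs
  imports "HOL-Probability.Probability" "HOL-Library.Poly_Mapping"
begin

section \<open>Scalings\<close>

text \<open>The set \<open>\<S>\<close> of pairs of nonnegative half-integers.\<close>

typedef scal = "{a :: real \<times> real. 2 * fst a \<in> \<nat> \<and> 2 * snd a \<in> \<nat>}"
  by (rule exI[of _ "(0, 0)"]) simp

setup_lifting type_definition_scal

lift_definition sc1 :: "scal \<Rightarrow> real" is fst .
lift_definition sc2 :: "scal \<Rightarrow> real" is snd .

lift_definition one_zero :: scal is "(1, 0)" by simp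
lift_definition half_half :: scal is "(1/2, 1/2)" by simp

lift_definition scal_mult :: "nat \<Rightarrow> scal \<Rightarrow> scal" is "\<lambda>l a. (real l * fst a, real l * snd a)"
  by (simp add: mult.left_commute[of 2] Nats_mult)

lemma scal_eqI: "sc1 a = sc1 b \<Longrightarrow> sc2 a = sc2 b \<Longrightarrow> a = b"
  by transfer (simp add: prod_eq_iff)

instantiation scal :: comm_monoid_add
begin

lift_definition zero_scal :: scal is "(0, 0)" by simp

lift_definition plus_scal :: "scal \<Rightarrow> scal \<Rightarrow> scal" is "\<lambda>a b. (fst a + fst b, snd a + snd b)"
  by (simp add: distrib_left Nats_add)

instance
  by standard (transfer; simp add: prod_eq_iff)+

end

text \<open>Note the reversed order in the second coordinate.\<close>

instantiation scal :: linorder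
begin

definition less_eq_scal :: "scal \<Rightarrow> scal \<Rightarrow> bool" where
  "a \<le> b \<longleftrightarrow> sc1 a < sc1 b \<or> sc1 a = sc1 b \<and> sc2 a \<ge> sc2 b"

definition less_scal :: "scal \<Rightarrow> scal \<Rightarrow> bool" where
  "(a :: scal) < b \<longleftrightarrow> a \<le> b \<and> a \<noteq> b"

instance
  by standard (auto simp: less_eq_scal_def less_scal_def intro: scal_eqI)

end

text \<open>The extension \<open>\<S>\<^sub>\<infinity>\<close>.\<close>

datatype scal_inf = SFin (the_scal: scal) | SInf

instantiation scal_inf :: comm_monoid_add
begin

definition zero_scal_inf :: scal_inf where
  "0 = SFin 0"

fun plus_scal_inf :: "scal_inf \<Rightarrow> scal_inf \<Rightarrow> scal_inf" where
  "SFin a + SFin b = SFin (a + b)"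
| "SInf + b = SInf"
| "a + SInf = SInf"

instance
proof
  fix a b c :: scal_inf
  show "a + b + c = a + (b + c)"
    by (cases a; cases b; cases c) (simp_all add: add.assoc)
  show "a + b = b + a"
    by (cases a; cases b) (simp_all add: add.commute)
  show "0 + a = a"
    by (cases a) (simp_all add: zero_scal_inf_def)
qed

end

instantiation scal_inf :: linorder
begin

fun less_eq_scal_inf :: "scal_inf \<Rightarrow> scal_inf \<Rightarrow> bool" where
  "SFin a \<le> SFin b \<longleftrightarrow> a \<le> b"
| "a \<le> SInf \<longleftrightarrow> True"
| "SInf \<le> SFin b \<longleftrightarrow> False"

definition less_scal_inf :: "scal_inf \<Rightarrow> scal_inf \<Rightarrow> bool" where
  "(a :: scal_inf) < b \<longleftrightarrow> a \<le> b \<and> a \<noteq> b"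

instance
proof
  fix a b c :: scal_inf
  show "a < b \<longleftrightarrow> a \<le> b \<and> \<not> b \<le> a"
    by (cases a; cases b) (auto simp: less_scal_inf_def)
  show "a \<le> a"
    by (cases a) simp_all
  show "a \<le> b \<Longrightarrow> b \<le> c \<Longrightarrow> a \<le> c"
    by (cases a; cases b; cases c) auto
  show "a \<le> b \<Longrightarrow> b \<le> a \<Longrightarrow> a = b"
    by (cases a; cases b) auto
  show "a \<le> b \<or> b \<le> a"
    by (cases a; cases b) auto
qed

end

fun proj1 :: "scal_inf \<Rightarrow> ereal" where
  "proj1 (SFin a) = ereal (sc1 a)"
| "proj1 SInf = \<infinity>"

definition scal_inf_mult :: "nat \<Rightarrow> scal_inf \<Rightarrow> scal_inf" where
  "scal_inf_mult l a =
     (case a of SFin b \<Rightarrow> SFin (scal_mult l b) | SInf \<Rightarrow> if l = 0 then 0 else SInf)"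

text \<open>\<open>\<epsilon>\<^sup>a\<close>, meaningful for \<open>0 < \<epsilon> < exp (- 1)\<close>, where \<open>ln (ln (1 / \<epsilon>)) > 0\<close>.\<close>

definition eps_pow :: "real \<Rightarrow> scal \<Rightarrow> real" where
  "eps_pow \<epsilon> a = \<epsilon> powr sc1 a * ln (ln (1 / \<epsilon>)) powr sc2 a"

lift_definition zero_half :: scal is "(0, 1/2)" by simp


section \<open>Polynomial vector fields\<close>

text \<open>A polynomial is given by its standard form: the finitely supported map from exponent
  vectors to coefficients. Its monomials are the elements of \<open>Poly_Mapping.keys p\<close>.\<close>

type_synonym 'n mpoly = "('n \<Rightarrow>\<^sub>0 nat) \<Rightarrow>\<^sub>0 real"
type_synonym 'n poly_field = "'n \<Rightarrow> 'n mpoly"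

definition mpoly_eval :: "'n::finite mpoly \<Rightarrow> real ^ 'n \<Rightarrow> real" where
  "mpoly_eval p x =
     (\<Sum>m\<in>Poly_Mapping.keys p.
        Poly_Mapping.lookup p m * (\<Prod>i\<in>UNIV. (x $ i) ^ Poly_Mapping.lookup m i))"

definition field_eval :: "'n::finite poly_field \<Rightarrow> real ^ 'n \<Rightarrow> real ^ 'n" where
  "field_eval P x = (\<chi> j. mpoly_eval (P j) x)"

definition mono_scal :: "('n::finite \<Rightarrow>\<^sub>0 nat) \<Rightarrow> ('n \<Rightarrow> scal_inf) \<Rightarrow> scal_inf" where
  "mono_scal m a = (\<Sum>i\<in>UNIV. scal_inf_mult (Poly_Mapping.lookup m i) (a i))"

definition poly_scal :: "'n::finite mpoly \<Rightarrow> ('n \<Rightarrow> scal_inf) \<Rightarrow> scal_inf" where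
  "poly_scal p a = (if p = 0 then SInf else Min ((\<lambda>m. mono_scal m a) ` Poly_Mapping.keys p))"


section \<open>The inductive procedure\<close>

text \<open>\<open>lev_set \<sigma> P l\<close> is \<open>I\<^sub>l\<close> and \<open>lev_scal \<sigma> P l j\<close> is \<open>a\<^bsub>l,j\<^esub>\<close>. Once the procedure has stopped,
  all further \<open>I\<^sub>l\<close> are empty and the \<open>a\<^bsub>l,j\<^esub>\<close> stay constant in \<open>l\<close>.\<close>

function lev_set :: "real ^ 'n \<Rightarrow> 'n::finite poly_field \<Rightarrow> nat \<Rightarrow> 'n set"
  and lev_scal :: "real ^ 'n \<Rightarrow> 'n poly_field \<Rightarrow> nat \<Rightarrow> 'n \<Rightarrow> scal_inf"
where
  "lev_set \<sigma> P 0 = {j. \<sigma> $ j > 0}"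
| "lev_set \<sigma> P (Suc l) =
     (let J = UNIV - (\<Union>k\<in>{..l}. lev_set \<sigma> P k);
          v = (\<lambda>j. poly_scal (P j) (lev_scal \<sigma> P l))
      in if J = {} \<or> (\<forall>j\<in>J. v j = SInf) then {}
         else {j \<in> J. proj1 (v j) = Min ((\<lambda>i. proj1 (v i)) ` J)})"
| "lev_scal \<sigma> P 0 = (\<lambda>j. if j \<in> lev_set \<sigma> P 0 then SFin half_half else SInf)"
| "lev_scal \<sigma> P (Suc l) =
     (\<lambda>j. if j \<in> lev_set \<sigma> P (Suc l) then poly_scal (P j) (lev_scal \<sigma> P l) + SFin one_zero
          else lev_scal \<sigma> P l j)"
  by pat_completeness auto
termination
  by (relation "Wellfounded.measure (case_sum (\<lambda>(_, _, l). 2 * l) (\<lambda>(_, _, l). 2 * l + 1))") auto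

definition noise_propagating :: "real ^ 'n \<Rightarrow> 'n::finite poly_field \<Rightarrow> bool" where
  "noise_propagating \<sigma> P \<longleftrightarrow> (\<exists>l. (\<Union>k\<in>{..l}. lev_set \<sigma> P k) = UNIV)"

definition sys_dim :: "real ^ 'n \<Rightarrow> 'n::finite poly_field \<Rightarrow> nat" where
  "sys_dim \<sigma> P = (LEAST l. (\<Union>k\<in>{..l}. lev_set \<sigma> P k) = UNIV)"

text \<open>The final scalings; all of them are finite if the system is noise propagating.\<close>

definition fin_scal :: "real ^ 'n \<Rightarrow> 'n::finite poly_field \<Rightarrow> 'n \<Rightarrow> scal" where
  "fin_scal \<sigma> P j = the_scal (lev_scal \<sigma> P (sys_dim \<sigma> P) j)"

text \<open>The \<open>I\<^sub>l\<close> are pairwise disjoint, so the index \<open>l\<close> below is unique.\<close>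

definition lead_field :: "real ^ 'n \<Rightarrow> 'n::finite poly_field \<Rightarrow> 'n poly_field" where
  "lead_field \<sigma> P j =
     (if j \<in> lev_set \<sigma> P 0 then 0
      else let a = lev_scal \<sigma> P (THE l. j \<in> lev_set \<sigma> P (Suc l))
           in \<Sum>m | m \<in> Poly_Mapping.keys (P j) \<and> mono_scal m a = poly_scal (P j) a.
                Poly_Mapping.single m (Poly_Mapping.lookup (P j) m))"


section \<open>Stochastic differential equations with additive noise\<close>

text \<open>Time is \<open>[0, \<infinity>)\<close>; values of filtrations and processes at negative times are irrelevant.\<close>

definition filtered_prob_space :: "'w measure \<Rightarrow> (real \<Rightarrow> 'w measure) \<Rightarrow> bool" where
  "filtered_prob_space M F \<longleftrightarrow>
     prob_space M \<and> (\<forall>t\<ge>0. subalgebra M (F t)) \<and>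
     (\<forall>s t. 0 \<le> s \<and> s \<le> t \<longrightarrow> sets (F s) \<subseteq> sets (F t))"

definition brownian_motion ::
  "'w measure \<Rightarrow> (real \<Rightarrow> 'w measure) \<Rightarrow> (real \<Rightarrow> 'w \<Rightarrow> real ^ 'n::finite) \<Rightarrow> bool" where
  "brownian_motion M F B \<longleftrightarrow>
     (\<forall>t\<ge>0. B t \<in> borel_measurable (F t)) \<and>
     (AE \<omega> in M. B 0 \<omega> = 0) \<and>
     (AE \<omega> in M. continuous_on {0..} (\<lambda>t. B t \<omega>)) \<and>
     (\<forall>s t. 0 \<le> s \<and> s < t \<longrightarrow>
        prob_space.indep_set M (sets (F s))
          {(\<lambda>\<omega>. B t \<omega> - B s \<omega>) -` A \<inter> space M | A. A \<in> sets borel} \<and>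
        prob_space.indep_vars M (\<lambda>_. borel) (\<lambda>i \<omega>. (B t \<omega> - B s \<omega>) $ i) UNIV \<and>
        (\<forall>i. distributed M lborel (\<lambda>\<omega>. (B t \<omega> - B s \<omega>) $ i)
               (\<lambda>y. ennreal (normal_density 0 (sqrt (t - s)) y))))"

definition diag_mat :: "real ^ 'n \<Rightarrow> real ^ 'n ^ 'n" where
  "diag_mat \<sigma> = (\<chi> i j. if i = j then \<sigma> $ i else 0)"

text \<open>\<open>x\<close> solves \<open>dx\<^sub>t = b(x\<^sub>t) dt + \<Sigma> dB\<^sub>t\<close>, \<open>x\<^sub>0 = x0\<close>, for all \<open>t < \<tau>\<close>. As the matrix \<open>\<Sigma>\<close> is
  constant, the stochastic integral of \<open>\<Sigma>\<close> up to time \<open>t\<close> is \<open>\<Sigma> B\<^sub>t\<close>. The values of \<open>x\<close> from time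
  \<open>\<tau>\<close> on are irrelevant.\<close>

definition solves_sde ::
  "'w measure \<Rightarrow> (real \<Rightarrow> 'w measure) \<Rightarrow> (real \<Rightarrow> 'w \<Rightarrow> real ^ 'n::finite) \<Rightarrow>
   (real ^ 'n \<Rightarrow> real ^ 'n) \<Rightarrow> real ^ 'n ^ 'n \<Rightarrow> real ^ 'n \<Rightarrow>
   (real \<Rightarrow> 'w \<Rightarrow> real ^ 'n) \<Rightarrow> ('w \<Rightarrow> ereal) \<Rightarrow> bool" where
  "solves_sde M F B b \<Sigma> x0 x \<tau> \<longleftrightarrow>
     filtered_prob_space M F \<and> brownian_motion M F B \<and>
     (\<forall>t\<ge>0. {\<omega> \<in> space M. ereal t < \<tau> \<omega>} \<in> sets (F t) \<and>
        x t \<in> borel_measurable (restrict_space (F t) {\<omega> \<in> space M. ereal t < \<tau> \<omega>})) \<and>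
     (AE \<omega> in M. x 0 \<omega> = x0 \<and>
        (\<forall>t\<ge>0. ereal t < \<tau> \<omega> \<longrightarrow>
           continuous_on {0..t} (\<lambda>s. x s \<omega>) \<and>
           (\<lambda>s. b (x s \<omega>)) absolutely_integrable_on {0..t} \<and>
           x t \<omega> = x0 + integral {0..t} (\<lambda>s. b (x s \<omega>)) + \<Sigma> *v B t \<omega>))"

text \<open>Explosion time of a path \<open>z\<close> defined on \<open>[0, \<zeta>)\<close>. A path is defined up to its explosion
  time iff this equals \<open>\<zeta>\<close>: if \<open>\<zeta> < \<infinity>\<close> and \<open>z\<close> does not explode at \<open>\<zeta>\<close>, the value is \<open>\<infinity>\<close>
  because \<open>Inf {} = \<infinity>\<close>.\<close>

definition explosion_time :: "(real \<Rightarrow> real ^ 'n::finite) \<Rightarrow> ereal \<Rightarrow> ereal" where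
  "explosion_time z \<zeta> =
     lim (\<lambda>k::nat. Inf {ereal t | t. 0 \<le> t \<and> ereal t < \<zeta> \<and> norm (z t) \<ge> real k})"

end

theory Submission
  imports Defs "HOL-Real_Asymp.Real_Asymp"
begin

text \<open>Write \<open>A\<^sub>j\<close> for the final scaling of the coordinate \<open>j\<close> and, for a monomial with exponent vector
  \<open>m\<close>, let \<open>s\<^sub>m = \<Sum>\<^sub>i m\<^sub>i A\<^sub>i\<close> (\<open>mono_val\<close>). Brownian scaling and a linear substitution turn the given
  equation into one for the rescaled process in which the monomial \<open>m\<close> of the \<open>j\<close>-th drift component
  is multiplied by \<open>\<epsilon>\<^bsup>s\<^sub>m + (1,0)\<^esup> / \<epsilon>\<^bsup>A\<^sub>j\<^esup>\<close>, and the noise coefficient \<open>\<sigma>\<^sup>j\<close> by \<open>\<epsilon>\<^bsup>(1/2,0)\<^esup> / \<epsilon>\<^bsup>A\<^sub>j\<^esup>\<close>. As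
  \<open>A\<^sub>j = (1/2, 1/2)\<close> wherever \<open>\<sigma>\<^sup>j > 0\<close>, the noise has the asserted form. The remainder is what is left
  of the drift after subtracting the leading field, so everything depends on the sizes of
  these powers.

  The order on scalings is made such that \<open>\<epsilon>\<^sup>a / \<epsilon>\<^sup>b \<rightarrow> 0\<close> if and only if \<open>b < a\<close>. Hence it is enough to
  know that \<open>A\<^sub>j \<le> s\<^sub>m + (1,0)\<close> for every monomial \<open>m\<close> of \<open>P\<^sup>j\<close>, with equality precisely for the
  monomials of the leading field (\<open>lookup_lead_field\<close>): leading monomials then keep their coefficient
  exactly, and all others get coefficients tending to 0.

  For \<open>j\<close> of level \<open>l + 1\<close> this balance holds by construction with respect to the scalings \<open>a\<^sub>l\<close> of
  step \<open>l\<close>, but the final scalings of variables that were still at \<open>\<infinity>\<close> in step \<open>l\<close> are smaller than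
  \<open>\<infinity>\<close>, so monomials containing such a variable might catch up. They do not: a variable assigned after
  step \<open>l\<close> has a scaling whose first coordinate exceeds that of \<open>P\<^sup>j(a\<^sub>l)\<close> by at least 1
  (\<open>late_scaling_ge\<close>). The reason is that the minimal first coordinates found by the procedure never
  decrease, and that integrating in time gains a further power of \<open>\<epsilon>\<close>.\<close>

section \<open>Arithmetic of scalings\<close>

lemma sc1_add: "sc1 (a + b) = sc1 a + sc1 b" by transfer simp
lemma sc2_add: "sc2 (a + b) = sc2 a + sc2 b" by transfer simp
lemma sc1_zero: "sc1 0 = 0" by transfer simp
lemma sc1_one_zero: "sc1 one_zero = 1" by transfer simp
lemma sc2_one_zero: "sc2 one_zero = 0" by transfer simp
lemma sc1_half_half: "sc1 half_half = 1/2" by transfer simp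
lemma sc2_half_half: "sc2 half_half = 1/2" by transfer simp
lemma sc1_zero_half: "sc1 zero_half = 0" by transfer simp
lemma sc2_zero_half: "sc2 zero_half = 1/2" by transfer simp
lemma sc2_zero: "sc2 0 = 0" by transfer simp
lemma sc1_scal_mult: "sc1 (scal_mult n a) = real n * sc1 a" by transfer simp
lemma sc2_scal_mult: "sc2 (scal_mult n a) = real n * sc2 a" by transfer simp
lemma sc1_nonneg: "sc1 a \<ge> 0" by transfer (auto elim!: Nats_cases)
lemma sc1_sum: "sc1 (\<Sum>i\<in>S. f i) = (\<Sum>i\<in>S. sc1 (f i))"
  by (induction S rule: infinite_finite_induct) (auto simp: sc1_add sc1_zero)

lemmas scal_simps = sc1_add sc2_add sc1_zero sc2_zero sc1_one_zero sc2_one_zero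
  sc1_half_half sc2_half_half sc1_zero_half sc2_zero_half sc1_scal_mult sc2_scal_mult

lemma scal_less_iff: "a < b \<longleftrightarrow> sc1 a < sc1 b \<or> sc1 a = sc1 b \<and> sc2 a > sc2 b"
  by (auto simp: less_scal_def less_eq_scal_def intro: scal_eqI)

lemma scal_add_less_cancel: "a + c < b + c \<longleftrightarrow> a < (b::scal)"
  by (auto simp: scal_less_iff scal_simps)

lemma proj1_mono: "a \<le> b \<Longrightarrow> proj1 a \<le> proj1 b"
  by (cases a; cases b) (auto simp: less_eq_scal_def)

section \<open>Values of monomials and polynomials\<close>

text \<open>The value of a monomial at finite scalings, as an element of \<open>\<S>\<close> rather than of \<open>\<S>\<^sub>\<infinity>\<close>; it is the
  exponent that the monomial acquires under the substitution \<open>x\<^sup>i \<mapsto> \<epsilon>\<^bsup>A\<^sub>i\<^esup> x\<^sup>i\<close>.\<close>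

definition mono_val :: "('n::finite \<Rightarrow>\<^sub>0 nat) \<Rightarrow> ('n \<Rightarrow> scal) \<Rightarrow> scal" where
  "mono_val m A = (\<Sum>i\<in>UNIV. scal_mult (Poly_Mapping.lookup m i) (A i))"

lemma sum_SFin: "(\<Sum>i\<in>S. SFin (f i)) = SFin (\<Sum>i\<in>S. f i)"
  by (induction S rule: infinite_finite_induct) (auto simp: zero_scal_inf_def)

lemma scal_mult_0: "scal_mult 0 a = 0"
  by transfer simp

text \<open>Only the variables that occur need a finite scaling, because \<open>0 \<cdot> \<infinity> = (0,0)\<close>. This is what allows
  values computed in the middle of the procedure to be compared with final ones.\<close>

lemma mono_scal_finite:
  assumes "\<And>i. Poly_Mapping.lookup m i \<noteq> 0 \<Longrightarrow> a i = SFin (A i)"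
  shows "mono_scal m a = SFin (mono_val m A)"
proof -
  have "scal_inf_mult (Poly_Mapping.lookup m i) (a i)
      = SFin (scal_mult (Poly_Mapping.lookup m i) (A i))" for i
    using assms[of i]
    by (cases "Poly_Mapping.lookup m i = 0"; cases "a i")
       (auto simp: scal_inf_mult_def zero_scal_inf_def scal_mult_0)
  then show ?thesis
    by (simp add: mono_scal_def mono_val_def sum_SFin)
qed

lemma mono_scal_infinite:
  assumes "Poly_Mapping.lookup m i \<noteq> 0" "a i = SInf"
  shows "mono_scal m a = SInf"
  using assms unfolding mono_scal_def
  by (subst sum.remove[of _ i]) (auto simp: scal_inf_mult_def)

text \<open>All scalings have a nonnegative first coordinate, so the factors besides one occurrence of the
  \<open>i\<close>-th variable cannot lower the value.\<close>

lemma sc1_mono_val_ge: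
  assumes "Poly_Mapping.lookup m i \<noteq> 0"
  shows "sc1 (A i) \<le> sc1 (mono_val m A)"
proof -
  have "sc1 (A i) \<le> real (Poly_Mapping.lookup m i) * sc1 (A i)"
    using assms sc1_nonneg[of "A i"] by (simp add: mult_le_cancel_right1)
  also have "\<dots> \<le> (\<Sum>i\<in>UNIV. real (Poly_Mapping.lookup m i) * sc1 (A i))"
    by (rule member_le_sum) (auto simp: sc1_nonneg)
  finally show ?thesis
    by (simp add: mono_val_def sc1_sum sc1_scal_mult)
qed

lemma poly_scal_le: "m \<in> Poly_Mapping.keys p \<Longrightarrow> poly_scal p a \<le> mono_scal m a"
  by (auto simp: poly_scal_def)

lemma poly_scal_attained:
  assumes "poly_scal p a = SFin c"
  obtains m where "m \<in> Poly_Mapping.keys p" "mono_scal m a = SFin c"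
proof -
  have "p \<noteq> 0"
    using assms by (auto simp: poly_scal_def)
  then have "poly_scal p a \<in> (\<lambda>m. mono_scal m a) ` Poly_Mapping.keys p"
    unfolding poly_scal_def by (auto intro!: Min_in)
  then show ?thesis
    using assms that by auto
qed

section \<open>The inductive procedure\<close>

lemma lev_set_Suc_unassigned:
  assumes "j \<in> lev_set \<sigma> P (Suc l)" "k \<le> l"
  shows "j \<notin> lev_set \<sigma> P k"
  using assms by (auto simp: Let_def split: if_splits)

text \<open>The two properties through which a step of the procedure is used: an index selected in it has a finite
  value, and that value is minimal in the first coordinate among all unassigned indices.
  Finiteness comes from minimality, as some unassigned index has a finite value.\<close>

lemma lev_set_Suc_minimal:
  assumes j: "j \<in> lev_set \<sigma> P (Suc l)"
  obtains c where "poly_scal (P j) (lev_scal \<sigma> P l) = SFin c"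
    "\<And>i. (\<And>k. k \<le> l \<Longrightarrow> i \<notin> lev_set \<sigma> P k) \<Longrightarrow>
        ereal (sc1 c) \<le> proj1 (poly_scal (P i) (lev_scal \<sigma> P l))"
proof -
  define J where "J = UNIV - (\<Union>k\<in>{..l}. lev_set \<sigma> P k)"
  define v where "v = (\<lambda>j. poly_scal (P j) (lev_scal \<sigma> P l))"
  have "j \<in> (if J = {} \<or> (\<forall>j\<in>J. v j = SInf) then {}
         else {j \<in> J. proj1 (v j) = Min ((\<lambda>i. proj1 (v i)) ` J)})"
    using j unfolding J_def v_def by (simp add: Let_def)
  then obtain i0 where i0: "i0 \<in> J" "v i0 \<noteq> SInf"
    and jmin: "proj1 (v j) = Min ((\<lambda>i. proj1 (v i)) ` J)"
    by (auto split: if_splits)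
  have le: "proj1 (v j) \<le> proj1 (v i)" if "i \<in> J" for i
    unfolding jmin using that by auto
  have "v j \<noteq> SInf"
    using le[OF i0(1)] i0(2) by (cases "v i0") auto
  then obtain c where c: "v j = SFin c"
    by (cases "v j") auto
  show ?thesis
  proof (rule that)
    show "poly_scal (P j) (lev_scal \<sigma> P l) = SFin c"
      using c by (simp add: v_def)
    show "ereal (sc1 c) \<le> proj1 (poly_scal (P i) (lev_scal \<sigma> P l))"
      if "\<And>k. k \<le> l \<Longrightarrow> i \<notin> lev_set \<sigma> P k" for i
      using le[of i] that c by (auto simp: J_def v_def)
  qed
qed

lemma lev_scal_eq_SInf_iff: "lev_scal \<sigma> P l i = SInf \<longleftrightarrow> (\<forall>k\<le>l. i \<notin> lev_set \<sigma> P k)"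
proof (induction l)
  case 0
  then show ?case by simp
next
  case (Suc l)
  show ?case
  proof (cases "i \<in> lev_set \<sigma> P (Suc l)")
    case True
    then obtain c where "poly_scal (P i) (lev_scal \<sigma> P l) = SFin c"
      by (rule lev_set_Suc_minimal)
    with True show ?thesis
      by (auto simp del: lev_set.simps)
  next
    case False
    with Suc show ?thesis
      by (auto simp del: lev_set.simps simp: le_Suc_eq)
  qed
qed

lemma lev_scal_stable:
  assumes "lev_scal \<sigma> P l i \<noteq> SInf" "l \<le> l'"
  shows "lev_scal \<sigma> P l' i = lev_scal \<sigma> P l i"
  using assms(2)
proof (induction l' rule: dec_induct)
  case base
  show ?case ..
next
  case (step n)
  have "lev_scal \<sigma> P n i \<noteq> SInf"
    using step assms(1) by simp
  then have "i \<notin> lev_set \<sigma> P (Suc n)"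
    using lev_set_Suc_unassigned[of i \<sigma> P n] by (auto simp: lev_scal_eq_SInf_iff)
  then show ?case
    using step.IH by (simp del: lev_set.simps)
qed

text \<open>A scaling is never revised once it is finite, so any finite intermediate scaling is already the
  final one.\<close>

lemma lev_scal_eq_fin_scal:
  assumes "noise_propagating \<sigma> P" "lev_scal \<sigma> P l i \<noteq> SInf"
  shows "lev_scal \<sigma> P l i = SFin (fin_scal \<sigma> P i)"
proof -
  let ?d = "sys_dim \<sigma> P"
  have "(\<Union>k\<in>{..?d}. lev_set \<sigma> P k) = UNIV"
    unfolding sys_dim_def using assms(1) unfolding noise_propagating_def by (rule LeastI_ex)
  then have "lev_scal \<sigma> P ?d i \<noteq> SInf"
    unfolding lev_scal_eq_SInf_iff by blast
  then have "SFin (fin_scal \<sigma> P i) = lev_scal \<sigma> P ?d i"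
    by (cases "lev_scal \<sigma> P ?d i") (auto simp: fin_scal_def)
  also have "\<dots> = lev_scal \<sigma> P (max ?d l) i"
    by (rule lev_scal_stable[OF \<open>lev_scal \<sigma> P ?d i \<noteq> SInf\<close> max.cobounded1, symmetric])
  also have "\<dots> = lev_scal \<sigma> P l i"
    by (rule lev_scal_stable[OF assms(2) max.cobounded2])
  finally show ?thesis ..
qed

text \<open>Why later levels are negligible. Suppose the variable \<open>i\<close> is assigned after step \<open>l\<close>, through a monomial
  \<open>m\<close> of \<open>P\<^sup>i\<close> that realises the value of \<open>P\<^sup>i\<close>. If all variables of \<open>m\<close> were assigned by step \<open>l\<close>, then \<open>m\<close> has the
  same value in step \<open>l\<close>. As \<open>i\<close> was unassigned when \<open>j\<close> was selected as minimal, the first coordinate of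
  that value is at least \<open>sc1 c\<close>. Otherwise \<open>m\<close> contains a variable that was itself assigned after
  step \<open>l\<close>, and by induction the first coordinate is at least \<open>sc1 c + 1\<close>. Passing from the value of
  \<open>P\<^sup>i\<close> to the scaling of \<open>i\<close> adds 1.\<close>

lemma late_scaling_ge:
  assumes j: "j \<in> lev_set \<sigma> P (Suc l)" and c: "poly_scal (P j) (lev_scal \<sigma> P l) = SFin c"
    and "l \<le> l'" and "lev_scal \<sigma> P l i = SInf" and "lev_scal \<sigma> P l' i = SFin d"
  shows "sc1 c + 1 \<le> sc1 d"
  using assms(3-)
proof (induction l' arbitrary: i d rule: dec_induct)
  case base
  then show ?case by simp
next
  case (step n)
  show ?case
  proof (cases "i \<in> lev_set \<sigma> P (Suc n)")
    case False
    with step show ?thesis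
      by (simp del: lev_set.simps)
  next
    case True
    then obtain e where e: "poly_scal (P i) (lev_scal \<sigma> P n) = SFin e"
      by (rule lev_set_Suc_minimal)
    then have d: "d = e + one_zero"
      using True step.prems by (simp del: lev_set.simps)
    obtain m where m: "m \<in> Poly_Mapping.keys (P i)" "mono_scal m (lev_scal \<sigma> P n) = SFin e"
      using poly_scal_attained[OF e] .
    define A where "A k = the_scal (lev_scal \<sigma> P n k)" for k
    have fin: "lev_scal \<sigma> P n k = SFin (A k)" if "Poly_Mapping.lookup m k \<noteq> 0" for k
      using mono_scal_infinite[of m k "lev_scal \<sigma> P n"] that m(2)
      by (cases "lev_scal \<sigma> P n k") (auto simp: A_def)
    then have e_eq: "e = mono_val m A"
      using m(2) mono_scal_finite[of m "lev_scal \<sigma> P n" A] by simp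
    have "sc1 c \<le> sc1 e"
    proof (cases "\<exists>k. Poly_Mapping.lookup m k \<noteq> 0 \<and> lev_scal \<sigma> P l k = SInf")
      case True
      then obtain k where k: "Poly_Mapping.lookup m k \<noteq> 0" "lev_scal \<sigma> P l k = SInf"
        by blast
      have "sc1 c + 1 \<le> sc1 (A k)"
        using step.IH[OF k(2) fin[OF k(1)]] .
      also have "\<dots> \<le> sc1 e"
        unfolding e_eq using k(1) by (rule sc1_mono_val_ge)
      finally show ?thesis by simp
    next
      case False
      have "lev_scal \<sigma> P l k = SFin (A k)" if "Poly_Mapping.lookup m k \<noteq> 0" for k
      proof -
        have "lev_scal \<sigma> P l k \<noteq> SInf"
          using False that by blast
        from lev_scal_stable[OF this step.hyps(1)] show ?thesis
          using fin[OF that] by simp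
      qed
      then have "mono_scal m (lev_scal \<sigma> P l) = SFin e"
        unfolding e_eq by (rule mono_scal_finite)
      then have "proj1 (poly_scal (P i) (lev_scal \<sigma> P l)) \<le> ereal (sc1 e)"
        using proj1_mono[OF poly_scal_le[OF m(1)], of "lev_scal \<sigma> P l"] by simp
      moreover have "ereal (sc1 c) \<le> proj1 (poly_scal (P i) (lev_scal \<sigma> P l))"
        using lev_set_Suc_minimal[OF j] c step.prems(1) unfolding lev_scal_eq_SInf_iff
        by (metis scal_inf.inject)
      ultimately show ?thesis
        using order_trans by fastforce
    qed
    then show ?thesis
      by (simp add: d scal_simps)
  qed
qed

text \<open>The value \<open>P\<^sup>j(a\<^sub>l)\<close> is a minimum over monomials, computed with the scalings of step \<open>l\<close>. Replacing these by the
  final scalings does not affect monomials of finite value, and those of infinite value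
  stay strictly above the minimum by the preceding lemma.\<close>

lemma leading_monomials_balance:
  assumes noise: "noise_propagating \<sigma> P" and j: "j \<in> lev_set \<sigma> P (Suc l)"
    and m: "m \<in> Poly_Mapping.keys (P j)"
  defines "A \<equiv> fin_scal \<sigma> P" and "a \<equiv> lev_scal \<sigma> P l"
  shows "A j \<le> mono_val m A + one_zero"
    and "A j = mono_val m A + one_zero \<longleftrightarrow> mono_scal m a = poly_scal (P j) a"
proof -
  obtain c where c: "poly_scal (P j) a = SFin c"
    unfolding a_def using j by (rule lev_set_Suc_minimal)
  then have "lev_scal \<sigma> P (Suc l) j = SFin (c + one_zero)"
    using j by (simp del: lev_set.simps add: a_def)
  then have Aj: "A j = c + one_zero"
    using lev_scal_eq_fin_scal[OF noise, of "Suc l" j] by (simp add: A_def)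
  have "A j \<le> mono_val m A + one_zero \<and>
      (A j = mono_val m A + one_zero \<longleftrightarrow> mono_scal m a = poly_scal (P j) a)"
  proof (cases "\<exists>k. Poly_Mapping.lookup m k \<noteq> 0 \<and> a k = SInf")
    case True
    then obtain k where k: "Poly_Mapping.lookup m k \<noteq> 0" "a k = SInf"
      by blast
    obtain l' where l': "lev_scal \<sigma> P l' k \<noteq> SInf"
      using noise unfolding noise_propagating_def lev_scal_eq_SInf_iff by blast
    have "lev_scal \<sigma> P (max l l') k = SFin (A k)"
      using lev_scal_stable[OF l', of "max l l'"] lev_scal_eq_fin_scal[OF noise l']
      by (simp add: A_def)
    then have "sc1 c + 1 \<le> sc1 (A k)"
      using k(2) c unfolding a_def by (intro late_scaling_ge[OF j, of _ "max l l'" k]) auto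
    also have "\<dots> \<le> sc1 (mono_val m A)"
      using k(1) by (rule sc1_mono_val_ge)
    finally have "A j < mono_val m A + one_zero"
      by (simp add: Aj scal_less_iff scal_simps)
    then show ?thesis
      using mono_scal_infinite[of m k a] k c by auto
  next
    case False
    then have ma: "mono_scal m a = SFin (mono_val m A)"
      using lev_scal_eq_fin_scal[OF noise] unfolding a_def A_def
      by (intro mono_scal_finite) blast
    have "c \<le> mono_val m A"
      using poly_scal_le[OF m, of a] c ma by simp
    then consider "c = mono_val m A" | "c < mono_val m A"
      by fastforce
    then show ?thesis
    proof cases
      case 1
      then show ?thesis by (simp add: Aj ma c)
    next
      case 2
      then have "A j < mono_val m A + one_zero"
        by (simp add: Aj scal_add_less_cancel)
      with 2 show ?thesis
        by (auto simp: ma c)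
    qed
  qed
  then show "A j \<le> mono_val m A + one_zero"
    and "A j = mono_val m A + one_zero \<longleftrightarrow> mono_scal m a = poly_scal (P j) a"
    by blast+
qed

lemma fin_scal_noisy:
  assumes "noise_propagating \<sigma> P" "\<sigma> $ j > 0"
  shows "fin_scal \<sigma> P j = half_half"
proof -
  have "lev_scal \<sigma> P 0 j = SFin half_half"
    using assms(2) by simp
  moreover from this have "lev_scal \<sigma> P 0 j = SFin (fin_scal \<sigma> P j)"
    by (intro lev_scal_eq_fin_scal[OF assms(1)]) (metis scal_inf.distinct(1))
  ultimately show ?thesis
    by (metis scal_inf.inject)
qed

text \<open>An intrinsic description of the leading field, which no longer mentions the levels: it collects the
  monomials whose time integral has exactly the scaling of the component. It covers the
  noisy components as well. There the leading field is 0, and no monomial can balance, as \<open>A\<^sub>j\<close>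
  has first coordinate \<open>1/2\<close> while time integrals contribute at least 1.\<close>

lemma lookup_lead_field:
  assumes noise: "noise_propagating \<sigma> P" and m: "m \<in> Poly_Mapping.keys (P j)"
  defines "A \<equiv> fin_scal \<sigma> P"
  shows "A j \<le> mono_val m A + one_zero"
    and "Poly_Mapping.lookup (lead_field \<sigma> P j) m =
      (if A j = mono_val m A + one_zero then Poly_Mapping.lookup (P j) m else 0)"
proof -
  have "A j \<le> mono_val m A + one_zero \<and> Poly_Mapping.lookup (lead_field \<sigma> P j) m =
      (if A j = mono_val m A + one_zero then Poly_Mapping.lookup (P j) m else 0)"
  proof (cases "j \<in> lev_set \<sigma> P 0")
    case True
    then have "A j = half_half"
      using fin_scal_noisy[OF noise] by (simp add: A_def)
    then have "A j < mono_val m A + one_zero"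
      using sc1_nonneg[of "mono_val m A"] by (simp add: scal_less_iff scal_simps)
    then show ?thesis
      using True by (auto simp: lead_field_def)
  next
    case False
    obtain l' where "j \<in> lev_set \<sigma> P l'"
      using noise unfolding noise_propagating_def by blast
    with False obtain l where l: "j \<in> lev_set \<sigma> P (Suc l)"
      by (cases l') auto
    have the_l: "(THE l. j \<in> lev_set \<sigma> P (Suc l)) = l"
    proof (rule the_equality)
      show "j \<in> lev_set \<sigma> P (Suc l)" by (rule l)
    next
      fix k assume k: "j \<in> lev_set \<sigma> P (Suc k)"
      show "k = l"
        using lev_set_Suc_unassigned[OF l, of "Suc k"] lev_set_Suc_unassigned[OF k, of "Suc l"] k l
        by (metis Suc_leI linorder_neqE_nat)
    qed
    let ?a = "lev_scal \<sigma> P l"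
    have "lead_field \<sigma> P j =
        (\<Sum>m | m \<in> Poly_Mapping.keys (P j) \<and> mono_scal m ?a = poly_scal (P j) ?a.
          Poly_Mapping.single m (Poly_Mapping.lookup (P j) m))"
      using False unfolding lead_field_def by (simp add: the_l Let_def del: lev_set.simps)
    then have "Poly_Mapping.lookup (lead_field \<sigma> P j) m =
        (if mono_scal m ?a = poly_scal (P j) ?a then Poly_Mapping.lookup (P j) m else 0)"
      using m by (simp add: lookup_sum lookup_single when_def)
    then show ?thesis
      using leading_monomials_balance[of \<sigma> P j l m] noise l m unfolding A_def by simp
  qed
  then show "A j \<le> mono_val m A + one_zero"
    and "Poly_Mapping.lookup (lead_field \<sigma> P j) m =
      (if A j = mono_val m A + one_zero then Poly_Mapping.lookup (P j) m else 0)"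
    by blast+
qed

lemma keys_lead_field: "Poly_Mapping.keys (lead_field \<sigma> P j) \<subseteq> Poly_Mapping.keys (P j)"
proof -
  let ?S = "\<lambda>a. \<Sum>m | m \<in> Poly_Mapping.keys (P j) \<and> mono_scal m a = poly_scal (P j) a.
      Poly_Mapping.single m (Poly_Mapping.lookup (P j) m)"
  have "Poly_Mapping.keys (?S a) \<subseteq> Poly_Mapping.keys (P j)" for a
    by (rule order_trans[OF keys_sum]) (auto split: if_splits)
  then show ?thesis
    by (auto simp: lead_field_def Let_def simp del: lev_set.simps)
qed

section \<open>Powers of the small parameter\<close>

lemma loglog_pos:
  fixes \<epsilon> :: real
  assumes "0 < \<epsilon>" "\<epsilon> < exp (- 1)"
  shows "ln (ln (1 / \<epsilon>)) > 0"
proof -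
  have "ln \<epsilon> < - 1"
    using assms ln_less_cancel_iff[of \<epsilon> "exp (- 1)"] by simp
  then have "ln (1 / \<epsilon>) > 1"
    using assms by (simp add: ln_div)
  then show ?thesis
    by (rule ln_gt_zero)
qed

lemma eps_pow_pos: "0 < \<epsilon> \<Longrightarrow> \<epsilon> < exp (- 1) \<Longrightarrow> eps_pow \<epsilon> a > 0"
  using loglog_pos[of \<epsilon>] by (simp add: eps_pow_def)

lemma eps_pow_add: "eps_pow \<epsilon> (a + b) = eps_pow \<epsilon> a * eps_pow \<epsilon> b"
  by (simp add: eps_pow_def scal_simps powr_add)

lemma eps_pow_zero: "0 < \<epsilon> \<Longrightarrow> \<epsilon> < exp (- 1) \<Longrightarrow> eps_pow \<epsilon> 0 = 1"
  using loglog_pos[of \<epsilon>] by (simp add: eps_pow_def scal_simps)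

lemma eps_pow_scal_mult:
  assumes "0 < \<epsilon>" "\<epsilon> < exp (- 1)"
  shows "eps_pow \<epsilon> (scal_mult n a) = eps_pow \<epsilon> a ^ n"
proof -
  have "u powr (real n * r) = (u powr r) ^ n" if "u > 0" for u r :: real
    using that by (simp add: powr_powr[symmetric] powr_realpow mult.commute[of _ r])
  then show ?thesis
    using assms(1) loglog_pos[OF assms] by (simp add: eps_pow_def scal_simps power_mult_distrib)
qed

lemma eps_pow_sum:
  "0 < \<epsilon> \<Longrightarrow> \<epsilon> < exp (- 1) \<Longrightarrow> eps_pow \<epsilon> (\<Sum>i\<in>S. f i) = (\<Prod>i\<in>S. eps_pow \<epsilon> (f i))"
  by (induction S rule: infinite_finite_induct) (auto simp: eps_pow_add eps_pow_zero)

lemma eps_pow_mono_val: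
  "0 < \<epsilon> \<Longrightarrow> \<epsilon> < exp (- 1) \<Longrightarrow>
    eps_pow \<epsilon> (mono_val m A) = (\<Prod>i\<in>UNIV. eps_pow \<epsilon> (A i) ^ Poly_Mapping.lookup m i)"
  by (simp add: mono_val_def eps_pow_sum eps_pow_scal_mult)

lemma eps_pow_one_zero: "0 < \<epsilon> \<Longrightarrow> \<epsilon> < exp (- 1) \<Longrightarrow> eps_pow \<epsilon> one_zero = \<epsilon>"
  using loglog_pos[of \<epsilon>] by (simp add: eps_pow_def scal_simps)

text \<open>This explains the reversed order in the second coordinate: \<open>\<epsilon>\<close> tends to 0 but
  \<open>log log \<epsilon>\<^sup>-\<^sup>1\<close> to infinity, and the latter is beaten by every positive power of \<open>\<epsilon>\<close>.\<close>

lemma eps_pow_ratio_tendsto_0: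
  assumes "b < a"
  shows "((\<lambda>\<epsilon>. eps_pow \<epsilon> a / eps_pow \<epsilon> b) \<longlongrightarrow> 0) (at_right 0)"
proof -
  have "((\<lambda>\<epsilon>::real. \<epsilon> powr p * ln (ln (1 / \<epsilon>)) powr q) \<longlongrightarrow> 0) (at_right 0)"
    if "p > 0 \<or> p = 0 \<and> q < 0" for p q
    using that
  proof
    assume "p > 0"
    then show ?thesis by real_asymp
  next
    assume "p = 0 \<and> q < 0"
    then have "((\<lambda>\<epsilon>::real. ln (ln (1 / \<epsilon>)) powr q) \<longlongrightarrow> 0) (at_right 0)"
      by real_asymp
    moreover have "\<forall>\<^sub>F \<epsilon>::real in at_right 0.
        ln (ln (1 / \<epsilon>)) powr q = \<epsilon> powr p * ln (ln (1 / \<epsilon>)) powr q"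
      using eventually_at_right_less[of "0::real"]
      by eventually_elim (use \<open>p = 0 \<and> q < 0\<close> in simp)
    ultimately show ?thesis
      by (rule Lim_transform_eventually)
  qed
  note this[of "sc1 a - sc1 b" "sc2 a - sc2 b"]
  then show ?thesis
    using assms by (auto simp: eps_pow_def powr_diff scal_less_iff)
qed

section \<open>Evaluation of polynomial vector fields\<close>

lemma mpoly_eval_superset:
  assumes "finite S" "Poly_Mapping.keys p \<subseteq> S"
  shows "mpoly_eval p x =
    (\<Sum>m\<in>S. Poly_Mapping.lookup p m * (\<Prod>i\<in>UNIV. (x $ i) ^ Poly_Mapping.lookup m i))"
  unfolding mpoly_eval_def using assms
  by (intro sum.mono_neutral_left) (auto simp: in_keys_iff)

lemma abs_mpoly_eval_le:
  assumes "norm x \<le> C" "finite S" "Poly_Mapping.keys p \<subseteq> S"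
  shows "\<bar>mpoly_eval p x\<bar>
    \<le> (\<Sum>m\<in>S. \<bar>Poly_Mapping.lookup p m\<bar> * (\<Prod>i\<in>UNIV. C ^ Poly_Mapping.lookup m i))"
  unfolding mpoly_eval_superset[OF assms(2,3)]
proof (rule order_trans[OF sum_abs], rule sum_mono)
  fix m
  have "\<bar>x $ i\<bar> \<le> C" for i
    using component_le_norm_cart[of x i] assms(1) by simp
  then have "(\<Prod>i\<in>UNIV. \<bar>x $ i\<bar> ^ Poly_Mapping.lookup m i) \<le> (\<Prod>i\<in>UNIV. C ^ Poly_Mapping.lookup m i)"
    by (intro prod_mono conjI power_mono) auto
  then show "\<bar>Poly_Mapping.lookup p m * (\<Prod>i\<in>UNIV. x $ i ^ Poly_Mapping.lookup m i)\<bar>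
      \<le> \<bar>Poly_Mapping.lookup p m\<bar> * (\<Prod>i\<in>UNIV. C ^ Poly_Mapping.lookup m i)"
    by (simp add: abs_mult abs_prod power_abs mult_left_mono)
qed

text \<open>Coefficientwise convergence suffices, because all the fields live on a common finite set of
  monomials, each of which is bounded on the ball.\<close>

lemma SUP_norm_field_eval_tendsto_0:
  fixes R :: "real \<Rightarrow> 'n::finite poly_field"
  assumes S: "\<And>j. finite (S j)" "\<And>\<epsilon> j. Poly_Mapping.keys (R \<epsilon> j) \<subseteq> S j"
    and lim: "\<And>j m. ((\<lambda>\<epsilon>. Poly_Mapping.lookup (R \<epsilon> j) m) \<longlongrightarrow> 0) F"
    and C: "C > 0"
  shows "((\<lambda>\<epsilon>. SUP y\<in>cball 0 C. norm (field_eval (R \<epsilon>) y)) \<longlongrightarrow> 0) F"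
proof -
  define b where "b \<epsilon> = (\<Sum>j\<in>UNIV. \<Sum>m\<in>S j.
    \<bar>Poly_Mapping.lookup (R \<epsilon> j) m\<bar> * (\<Prod>i\<in>UNIV. C ^ Poly_Mapping.lookup m i))" for \<epsilon>
  have bound: "norm (field_eval (R \<epsilon>) y) \<le> b \<epsilon>" if "y \<in> cball 0 C" for \<epsilon> y
  proof -
    have "norm (field_eval (R \<epsilon>) y) \<le> (\<Sum>j\<in>UNIV. \<bar>mpoly_eval (R \<epsilon> j) y\<bar>)"
      using norm_le_l1_cart[of "field_eval (R \<epsilon>) y"] by (simp add: field_eval_def)
    also have "\<dots> \<le> b \<epsilon>"
      unfolding b_def using that S by (intro sum_mono abs_mpoly_eval_le) auto
    finally show ?thesis .
  qed
  have ne: "cball 0 C \<noteq> ({} :: (real ^ 'n) set)"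
    using C by simp
  have upper: "(SUP y\<in>cball 0 C. norm (field_eval (R \<epsilon>) y)) \<le> b \<epsilon>" for \<epsilon>
    using ne bound by (rule cSUP_least)
  \<comment> \<open>nonnegativity of the supremum needs the set to be bounded above, since \<open>Sup\<close> is unspecified otherwise\<close>
  have lower: "0 \<le> (SUP y\<in>cball 0 C. norm (field_eval (R \<epsilon>) y))" for \<epsilon>
  proof -
    have "bdd_above ((\<lambda>y. norm (field_eval (R \<epsilon>) y)) ` cball 0 C)"
      using bound by (intro bdd_aboveI2) auto
    then have "norm (field_eval (R \<epsilon>) 0) \<le> (SUP y\<in>cball 0 C. norm (field_eval (R \<epsilon>) y))"
      using C by (intro cSUP_upper) auto
    then show ?thesis
      using norm_ge_zero order_trans by blast
  qed
  have b_lim: "(b \<longlongrightarrow> 0) F"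
    unfolding b_def
    by (intro tendsto_null_sum tendsto_mult_left_zero tendsto_rabs_zero lim)
  show ?thesis
    by (rule tendsto_sandwich[OF _ _ tendsto_const b_lim]) (auto simp: lower upper)
qed

section \<open>Time change and linear change of coordinates\<close>

lemma filtered_prob_space_time_change:
  assumes "filtered_prob_space M F" "\<epsilon> > 0"
  shows "filtered_prob_space M (\<lambda>t. F (\<epsilon> * t))"
  using assms by (auto simp: filtered_prob_space_def)

lemma brownian_motion_scaling:
  assumes fp: "filtered_prob_space M F" and bm: "brownian_motion M F B" and e: "\<epsilon> > 0"
  shows "brownian_motion M (\<lambda>t. F (\<epsilon> * t)) (\<lambda>t \<omega>. (1 / sqrt \<epsilon>) *\<^sub>R B (\<epsilon> * t) \<omega>)"
proof -
  interpret prob_space M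
    using fp by (simp add: filtered_prob_space_def)
  let ?c = "1 / sqrt \<epsilon>"
  have c: "?c > 0"
    using e by simp
  have meas: "(\<lambda>\<omega>. ?c *\<^sub>R B (\<epsilon> * t) \<omega>) \<in> borel_measurable (F (\<epsilon> * t))" if "t \<ge> 0" for t
  proof (intro borel_measurable_scaleR borel_measurable_const)
    show "B (\<epsilon> * t) \<in> borel_measurable (F (\<epsilon> * t))"
      using bm that e unfolding brownian_motion_def by simp
  qed
  have start: "AE \<omega> in M. ?c *\<^sub>R B (\<epsilon> * 0) \<omega> = 0"
    using bm by (auto simp: brownian_motion_def)
  have "AE \<omega> in M. continuous_on {0..} (\<lambda>t. B t \<omega>)"
    using bm by (auto simp: brownian_motion_def)
  then have cont: "AE \<omega> in M. continuous_on {0..} (\<lambda>t. ?c *\<^sub>R B (\<epsilon> * t) \<omega>)"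
  proof eventually_elim
    case (elim \<omega>)
    have "continuous_on {0..} (\<lambda>t. B (\<epsilon> * t) \<omega>)"
      by (rule continuous_on_compose2[OF elim]) (use e in \<open>auto intro!: continuous_intros\<close>)
    then show ?case
      by (intro continuous_intros)
  qed
  have "indep_set (sets (F (\<epsilon> * s)))
      {(\<lambda>\<omega>. ?c *\<^sub>R B (\<epsilon> * t) \<omega> - ?c *\<^sub>R B (\<epsilon> * s) \<omega>) -` A \<inter> space M | A. A \<in> sets borel}
    \<and> indep_vars (\<lambda>_. borel) (\<lambda>i \<omega>. (?c *\<^sub>R B (\<epsilon> * t) \<omega> - ?c *\<^sub>R B (\<epsilon> * s) \<omega>) $ i) UNIV
    \<and> (\<forall>i. distributed M lborel (\<lambda>\<omega>. (?c *\<^sub>R B (\<epsilon> * t) \<omega> - ?c *\<^sub>R B (\<epsilon> * s) \<omega>) $ i)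
         (\<lambda>y. ennreal (normal_density 0 (sqrt (t - s)) y)))"
    if st: "0 \<le> s" "s < t" for s t
  proof -
    define D where "D \<omega> = B (\<epsilon> * t) \<omega> - B (\<epsilon> * s) \<omega>" for \<omega>
    have scaled: "?c *\<^sub>R B (\<epsilon> * t) \<omega> - ?c *\<^sub>R B (\<epsilon> * s) \<omega> = ?c *\<^sub>R D \<omega>" for \<omega>
      by (simp add: D_def algebra_simps)
    have *: "0 \<le> \<epsilon> * s \<and> \<epsilon> * s < \<epsilon> * t"
      using st e by simp
    have ind: "indep_set (sets (F (\<epsilon> * s))) {D -` A \<inter> space M | A. A \<in> sets borel}"
      and vars: "indep_vars (\<lambda>_. borel) (\<lambda>i \<omega>. D \<omega> $ i) UNIV"
      and dist: "\<And>i. distributed M lborel (\<lambda>\<omega>. D \<omega> $ i)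
         (\<lambda>y. ennreal (normal_density 0 (sqrt (\<epsilon> * t - \<epsilon> * s)) y))"
      using bm * unfolding brownian_motion_def D_def by blast+
    \<comment> \<open>the scaled increment generates no new events, as scaling is measurable\<close>
    have sub: "{(\<lambda>\<omega>. ?c *\<^sub>R D \<omega>) -` A \<inter> space M | A. A \<in> sets borel}
        \<subseteq> {D -` A \<inter> space M | A. A \<in> sets borel}"
    proof clarify
      fix A :: "(real ^ 'b) set" assume "A \<in> sets borel"
      then have "(\<lambda>v. ?c *\<^sub>R v) -` A \<inter> space borel \<in> sets borel"
        by (intro measurable_sets[of _ borel borel]) simp_all
      then show "\<exists>A'. (\<lambda>\<omega>. ?c *\<^sub>R D \<omega>) -` A \<inter> space M = D -` A' \<inter> space M \<and> A' \<in> sets borel"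
        by (intro exI[of _ "(\<lambda>v. ?c *\<^sub>R v) -` A"]) auto
    qed
    have "indep_set (sets (F (\<epsilon> * s)))
        {(\<lambda>\<omega>. ?c *\<^sub>R D \<omega>) -` A \<inter> space M | A. A \<in> sets borel}"
      using ind unfolding indep_set_def
      by (rule indep_sets_mono_sets) (use sub in \<open>auto split: bool.split\<close>)
    moreover have "indep_vars (\<lambda>_. borel) (\<lambda>i \<omega>. ?c * D \<omega> $ i) UNIV"
      by (rule indep_vars_compose2[OF vars]) simp
    moreover have "distributed M lborel (\<lambda>\<omega>. ?c * D \<omega> $ i)
         (\<lambda>y. ennreal (normal_density 0 (sqrt (t - s)) y))" for i
    proof -
      have "sqrt (\<epsilon> * t - \<epsilon> * s) = sqrt \<epsilon> * sqrt (t - s)"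
        by (simp add: real_sqrt_mult flip: right_diff_distrib)
      moreover have "sqrt (\<epsilon> * t - \<epsilon> * s) > 0"
        using * by simp
      ultimately show ?thesis
        using normal_density_affine[OF dist[of i], of ?c 0] c e by simp
    qed
    ultimately show ?thesis
      unfolding scaled by simp
  qed
  with meas start cont show ?thesis
    unfolding brownian_motion_def by blast
qed

lemma absolutely_integrable_time_change:
  fixes f :: "real \<Rightarrow> real ^ 'n::finite"
  assumes "f absolutely_integrable_on {0..\<epsilon> * t}" "\<epsilon> > 0"
  shows "(\<lambda>s. f (\<epsilon> * s)) absolutely_integrable_on {0..t}"
    and "integral {0..t} (\<lambda>s. f (\<epsilon> * s)) = (1 / \<epsilon>) *\<^sub>R integral {0..\<epsilon> * t} f"
proof -
  have img: "(\<lambda>x. x / \<epsilon>) ` {0..\<epsilon> * t} = {0..t}"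
    using assms(2) by (auto simp: field_simps image_iff intro!: bexI[of _ "\<epsilon> * _"])
  have stretch: "((\<lambda>s. g (\<epsilon> * s)) has_integral (1 / \<epsilon>) *\<^sub>R integral {0..\<epsilon> * t} g) {0..t}"
    if "g integrable_on {0..\<epsilon> * t}" for g :: "real \<Rightarrow> 'b::euclidean_space"
    using has_integral_stretch_real[OF integrable_integral[OF that], of \<epsilon>] assms(2)
    by (simp add: img)
  show "(\<lambda>s. f (\<epsilon> * s)) absolutely_integrable_on {0..t}"
    using assms(1) stretch[of f] stretch[of "\<lambda>s. norm (f s)"]
    unfolding absolutely_integrable_on_def by blast
  show "integral {0..t} (\<lambda>s. f (\<epsilon> * s)) = (1 / \<epsilon>) *\<^sub>R integral {0..\<epsilon> * t} f"
    using assms(1) stretch[of f] unfolding absolutely_integrable_on_def by blast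
qed

text \<open>Equations with additive noise are integral equations along each path, so the time change is the substitution
  rule and the coordinate change commutes with the integral by linearity. The hypotheses on
  \<open>b'\<close> and \<open>\<Sigma>'\<close> say that the new coefficients are the old ones in the new coordinates, the factor
  \<open>\<epsilon>\<close> coming from \<open>dt\<close> and the factor \<open>sqrt \<epsilon>\<close> from expressing \<open>B\<close> through the scaled Brownian motion.\<close>

lemma solves_sde_rescale:
  fixes x :: "real \<Rightarrow> 'w \<Rightarrow> real ^ 'n::finite" and d :: "'n \<Rightarrow> real"
  assumes sol: "solves_sde M F B b \<Sigma> x0 x \<tau>" and e: "\<epsilon> > 0"
    and drift: "\<And>z. b' (\<chi> j. z $ j / d j) = (\<chi> j. \<epsilon> * b z $ j / d j)"
    and noise: "\<And>v. \<Sigma>' *v v = (\<chi> j. sqrt \<epsilon> * (\<Sigma> *v v) $ j / d j)"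
  shows "solves_sde M (\<lambda>t. F (\<epsilon> * t)) (\<lambda>t \<omega>. (1 / sqrt \<epsilon>) *\<^sub>R B (\<epsilon> * t) \<omega>) b' \<Sigma>'
    (\<chi> j. x0 $ j / d j) (\<lambda>t \<omega>. \<chi> j. x (\<epsilon> * t) \<omega> $ j / d j) (\<lambda>\<omega>. \<tau> \<omega> / ereal \<epsilon>)"
proof -
  \<comment> \<open>the change of coordinates, through which all conditions are transported\<close>
  define T :: "real ^ 'n \<Rightarrow> real ^ 'n" where "T = (\<lambda>z. \<chi> j. z $ j / d j)"
  have lin: "linear T"
    by (rule linearI) (auto simp: T_def vec_eq_iff add_divide_distrib)
  have bl: "bounded_linear T"
    using lin by (simp add: linear_conv_bounded_linear)
  have T_cont: "continuous_on UNIV T"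
    using lin by (simp add: linear_continuous_on bl)
  have T_meas: "T \<in> borel_measurable borel"
    using T_cont by (rule borel_measurable_continuous_onI)
  have drift': "b' (T z) = T (\<epsilon> *\<^sub>R b z)" for z
    unfolding T_def drift by simp
  have noise': "\<Sigma>' *v ((1 / sqrt \<epsilon>) *\<^sub>R v) = T (\<Sigma> *v v)" for v
    unfolding T_def noise using e by (simp add: vec_eq_iff matrix_vector_mult_scaleR)
  have less: "ereal t < s / ereal \<epsilon> \<longleftrightarrow> ereal (\<epsilon> * t) < s" for t s
    using e by (cases s) (auto simp: field_simps)
  have fp: "filtered_prob_space M F" and bm: "brownian_motion M F B"
    and adapted: "\<And>t. t \<ge> 0 \<Longrightarrow> {\<omega> \<in> space M. ereal t < \<tau> \<omega>} \<in> sets (F t) \<and>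
        x t \<in> borel_measurable (restrict_space (F t) {\<omega> \<in> space M. ereal t < \<tau> \<omega>})"
    and path: "AE \<omega> in M. x 0 \<omega> = x0 \<and>
        (\<forall>t\<ge>0. ereal t < \<tau> \<omega> \<longrightarrow>
           continuous_on {0..t} (\<lambda>s. x s \<omega>) \<and>
           (\<lambda>s. b (x s \<omega>)) absolutely_integrable_on {0..t} \<and>
           x t \<omega> = x0 + integral {0..t} (\<lambda>s. b (x s \<omega>)) + \<Sigma> *v B t \<omega>)"
    using sol by (auto simp: solves_sde_def)
  have adapted': "{\<omega> \<in> space M. ereal (\<epsilon> * t) < \<tau> \<omega>} \<in> sets (F (\<epsilon> * t)) \<and>
      (\<lambda>\<omega>. T (x (\<epsilon> * t) \<omega>))
        \<in> borel_measurable (restrict_space (F (\<epsilon> * t)) {\<omega> \<in> space M. ereal (\<epsilon> * t) < \<tau> \<omega>})"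
    if "t \<ge> 0" for t
    using adapted[of "\<epsilon> * t"] that e by (auto intro: measurable_compose[OF _ T_meas])
  have path': "AE \<omega> in M. T (x (\<epsilon> * 0) \<omega>) = T x0 \<and>
        (\<forall>t\<ge>0. ereal (\<epsilon> * t) < \<tau> \<omega> \<longrightarrow>
           continuous_on {0..t} (\<lambda>s. T (x (\<epsilon> * s) \<omega>)) \<and>
           (\<lambda>s. b' (T (x (\<epsilon> * s) \<omega>))) absolutely_integrable_on {0..t} \<and>
           T (x (\<epsilon> * t) \<omega>) = T x0 + integral {0..t} (\<lambda>s. b' (T (x (\<epsilon> * s) \<omega>)))
             + \<Sigma>' *v ((1 / sqrt \<epsilon>) *\<^sub>R B (\<epsilon> * t) \<omega>))"
    using path
  proof eventually_elim
    case (elim \<omega>)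
    have "continuous_on {0..t} (\<lambda>s. T (x (\<epsilon> * s) \<omega>)) \<and>
           (\<lambda>s. b' (T (x (\<epsilon> * s) \<omega>))) absolutely_integrable_on {0..t} \<and>
           T (x (\<epsilon> * t) \<omega>) = T x0 + integral {0..t} (\<lambda>s. b' (T (x (\<epsilon> * s) \<omega>)))
             + \<Sigma>' *v ((1 / sqrt \<epsilon>) *\<^sub>R B (\<epsilon> * t) \<omega>)"
      if t: "t \<ge> 0" "ereal (\<epsilon> * t) < \<tau> \<omega>" for t
    proof -
      let ?f = "\<lambda>s. b (x s \<omega>)"
      have cont: "continuous_on {0..\<epsilon> * t} (\<lambda>s. x s \<omega>)"
        and int: "?f absolutely_integrable_on {0..\<epsilon> * t}"
        and eq: "x (\<epsilon> * t) \<omega> = x0 + integral {0..\<epsilon> * t} ?f + \<Sigma> *v B (\<epsilon> * t) \<omega>"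
        using elim t e by auto
      have "continuous_on {0..t} (\<lambda>s. x (\<epsilon> * s) \<omega>)"
        by (rule continuous_on_compose2[OF cont]) (use e in \<open>auto intro!: continuous_intros\<close>)
      then have C: "continuous_on {0..t} (\<lambda>s. T (x (\<epsilon> * s) \<omega>))"
        by (rule continuous_on_compose2[OF T_cont]) auto
      have bT: "bounded_linear (\<lambda>v. T (\<epsilon> *\<^sub>R v))"
        by (rule bounded_linear_compose[OF bl bounded_linear_scaleR_right])
      note chg = absolutely_integrable_time_change[OF int e]
      have I: "(\<lambda>s. b' (T (x (\<epsilon> * s) \<omega>))) absolutely_integrable_on {0..t}"
        using absolutely_integrable_linear[OF chg(1) bT] by (simp add: drift' o_def)
      have "integral {0..t} (\<lambda>s. b' (T (x (\<epsilon> * s) \<omega>)))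
          = T (\<epsilon> *\<^sub>R integral {0..t} (\<lambda>s. ?f (\<epsilon> * s)))"
        using integral_linear[OF set_lebesgue_integral_eq_integral(1)[OF chg(1)] bT]
        by (simp add: drift' o_def)
      also have "\<dots> = T (integral {0..\<epsilon> * t} ?f)"
        using e by (simp add: chg(2))
      finally show ?thesis
        using C I by (simp add: noise' eq linear_add[OF lin])
    qed
    with elim show ?case
      by simp
  qed
  show ?thesis
    unfolding solves_sde_def less
    using filtered_prob_space_time_change[OF fp e] brownian_motion_scaling[OF fp bm e] adapted' path'
    unfolding T_def by blast
qed

section \<open>The rescaled system\<close>

text \<open>The factor that the monomial \<open>m\<close> of the \<open>j\<close>-th component acquires when time is scaled by \<open>\<epsilon>\<close> and the
  \<open>i\<close>-th coordinate by \<open>\<epsilon>\<^bsup>A\<^sub>i\<^esup>\<close> for all \<open>i\<close>.\<close>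

definition rescaled_coeff :: "('n::finite \<Rightarrow> scal) \<Rightarrow> 'n \<Rightarrow> ('n \<Rightarrow>\<^sub>0 nat) \<Rightarrow> real \<Rightarrow> real" where
  "rescaled_coeff A j m \<epsilon> = eps_pow \<epsilon> (mono_val m A + one_zero) / eps_pow \<epsilon> (A j)"

definition remainder_field ::
  "real ^ 'n \<Rightarrow> 'n::finite poly_field \<Rightarrow> real \<Rightarrow> 'n poly_field" where
  "remainder_field \<sigma> P \<epsilon> j =
    Poly_Mapping.mapp (\<lambda>m c. c * rescaled_coeff (fin_scal \<sigma> P) j m \<epsilon>
      - Poly_Mapping.lookup (lead_field \<sigma> P j) m) (P j)"

lemma lookup_remainder_field:
  assumes "m \<in> Poly_Mapping.keys (P j)"
  shows "Poly_Mapping.lookup (remainder_field \<sigma> P \<epsilon> j) m =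
    Poly_Mapping.lookup (P j) m * rescaled_coeff (fin_scal \<sigma> P) j m \<epsilon>
      - Poly_Mapping.lookup (lead_field \<sigma> P j) m"
  using assms by (simp add: remainder_field_def lookup_mapp)

lemma keys_remainder_field:
  "Poly_Mapping.keys (remainder_field \<sigma> P \<epsilon> j) \<subseteq> Poly_Mapping.keys (P j)"
  unfolding remainder_field_def by (rule keys_mapp_subset)

text \<open>Let \<open>s\<^sub>m\<close> be the value of \<open>m\<close> at the final scalings. At the point with coordinates \<open>z\<^sup>i / \<epsilon>\<^bsup>A\<^sub>i\<^esup>\<close> the monomial \<open>m\<close> takes its value at \<open>z\<close> divided by \<open>\<epsilon>\<^bsup>s\<^sub>m\<^esup>\<close>, which
  cancels the power \<open>\<epsilon>\<^bsup>s\<^sub>m\<^esup>\<close> in its rescaled coefficient; what remains is the factor \<open>\<epsilon> / \<epsilon>\<^bsup>A\<^sub>j\<^esup>\<close>, the same for all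
  monomials of a component.\<close>

lemma eval_lead_plus_remainder:
  fixes \<sigma> :: "real ^ 'n" and P :: "'n::finite poly_field"
  assumes e: "0 < \<epsilon>" "\<epsilon> < exp (- 1)"
  defines "A \<equiv> fin_scal \<sigma> P"
  shows "field_eval (lead_field \<sigma> P) (\<chi> i. z $ i / eps_pow \<epsilon> (A i))
      + field_eval (remainder_field \<sigma> P \<epsilon>) (\<chi> i. z $ i / eps_pow \<epsilon> (A i))
    = (\<chi> j. \<epsilon> * field_eval P z $ j / eps_pow \<epsilon> (A j))"
proof -
  define y :: "real ^ 'n" where "y = (\<chi> i. z $ i / eps_pow \<epsilon> (A i))"
  have "mpoly_eval (lead_field \<sigma> P j) y + mpoly_eval (remainder_field \<sigma> P \<epsilon> j) y
      = \<epsilon> * mpoly_eval (P j) z / eps_pow \<epsilon> (A j)" for j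
  proof -
    have "mpoly_eval (lead_field \<sigma> P j) y + mpoly_eval (remainder_field \<sigma> P \<epsilon> j) y
        = (\<Sum>m\<in>Poly_Mapping.keys (P j).
            Poly_Mapping.lookup (P j) m * rescaled_coeff A j m \<epsilon>
              * (\<Prod>i\<in>UNIV. (y $ i) ^ Poly_Mapping.lookup m i))"
      unfolding mpoly_eval_superset[OF finite_keys keys_lead_field]
        mpoly_eval_superset[OF finite_keys keys_remainder_field] sum.distrib[symmetric]
      by (rule sum.cong) (auto simp: lookup_remainder_field A_def algebra_simps)
    also have "\<dots> = (\<Sum>m\<in>Poly_Mapping.keys (P j). \<epsilon> / eps_pow \<epsilon> (A j) *
            (Poly_Mapping.lookup (P j) m * (\<Prod>i\<in>UNIV. (z $ i) ^ Poly_Mapping.lookup m i)))"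
    proof (rule sum.cong[OF refl])
      fix m
      have nz: "eps_pow \<epsilon> a \<noteq> 0" for a
        using eps_pow_pos[OF e, of a] by simp
      have "(\<Prod>i\<in>UNIV. (z $ i) ^ Poly_Mapping.lookup m i)
          = eps_pow \<epsilon> (mono_val m A) * (\<Prod>i\<in>UNIV. (y $ i) ^ Poly_Mapping.lookup m i)"
        unfolding eps_pow_mono_val[OF e] prod.distrib[symmetric] power_mult_distrib[symmetric]
        by (simp add: y_def nz)
      then show "Poly_Mapping.lookup (P j) m * rescaled_coeff A j m \<epsilon>
              * (\<Prod>i\<in>UNIV. (y $ i) ^ Poly_Mapping.lookup m i)
          = \<epsilon> / eps_pow \<epsilon> (A j) *
            (Poly_Mapping.lookup (P j) m * (\<Prod>i\<in>UNIV. (z $ i) ^ Poly_Mapping.lookup m i))"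
        by (simp add: rescaled_coeff_def eps_pow_add eps_pow_one_zero[OF e])
    qed
    also have "\<dots> = \<epsilon> * mpoly_eval (P j) z / eps_pow \<epsilon> (A j)"
      by (simp add: mpoly_eval_def sum_distrib_left sum_divide_distrib)
    finally show ?thesis .
  qed
  then show ?thesis
    unfolding y_def[symmetric] by (simp add: field_eval_def vec_eq_iff)
qed

text \<open>A balanced monomial is leading and has factor 1, so its coefficient in the remainder vanishes
  for all small \<open>\<epsilon>\<close>. Any other monomial does not occur in the leading field, and its factor tends to 0.\<close>

lemma lookup_remainder_field_tendsto_0:
  assumes noise: "noise_propagating \<sigma> P"
  shows "((\<lambda>\<epsilon>. Poly_Mapping.lookup (remainder_field \<sigma> P \<epsilon> j) m) \<longlongrightarrow> 0) (at_right 0)"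
proof (cases "m \<in> Poly_Mapping.keys (P j)")
  case False
  then have "Poly_Mapping.lookup (remainder_field \<sigma> P \<epsilon> j) m = 0" for \<epsilon>
    using keys_remainder_field[of \<sigma> P \<epsilon> j] by (auto simp: in_keys_iff)
  then show ?thesis by simp
next
  case m: True
  let ?A = "fin_scal \<sigma> P"
  note lead = lookup_lead_field[OF noise m]
  show ?thesis
  proof (cases "?A j = mono_val m ?A + one_zero")
    case True
    have "\<forall>\<^sub>F \<epsilon>::real in at_right 0. 0 < \<epsilon> \<and> \<epsilon> < exp (- 1)"
      using eventually_at_right_real[of 0 "exp (- 1)"] by simp
    then have "\<forall>\<^sub>F \<epsilon> in at_right 0. Poly_Mapping.lookup (remainder_field \<sigma> P \<epsilon> j) m = 0"
    proof eventually_elim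
      case (elim \<epsilon>)
      then have "eps_pow \<epsilon> (?A j) > 0"
        by (intro eps_pow_pos) auto
      with True show ?case
        by (simp add: lookup_remainder_field[where P = P and j = j, OF m] lead(2) rescaled_coeff_def)
    qed
    then show ?thesis
      by (rule tendsto_eventually)
  next
    case False
    then have "?A j < mono_val m ?A + one_zero"
      using lead(1) by simp
    from tendsto_mult_right_zero[OF eps_pow_ratio_tendsto_0[OF this]] False show ?thesis
      by (simp add: lookup_remainder_field[where P = P and j = j, OF m] lead(2) rescaled_coeff_def)
  qed
qed

theorem theorem4p4:
  fixes P :: "'n::finite poly_field" and \<sigma> :: "real ^ 'n"
    and M :: "'w measure" and F :: "real \<Rightarrow> 'w measure"
    and B x :: "real \<Rightarrow> 'w \<Rightarrow> real ^ 'n" and \<tau> :: "'w \<Rightarrow> ereal"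
  assumes sigma_nonneg: "\<And>i. \<sigma> $ i \<ge> 0"
    and solution: "solves_sde M F B (field_eval P) (diag_mat \<sigma>) 0 x \<tau>"
    and explosion: "AE \<omega> in M. explosion_time (\<lambda>t. x t \<omega>) (\<tau> \<omega>) = \<tau> \<omega>"
    and noise: "noise_propagating \<sigma> P"
  shows "\<exists>R :: real \<Rightarrow> 'n poly_field.
    (\<forall>\<epsilon>. 0 < \<epsilon> \<and> \<epsilon> < exp (- 1) \<longrightarrow>
       solves_sde M (\<lambda>t. F (\<epsilon> * t)) (\<lambda>t \<omega>. (1 / sqrt \<epsilon>) *\<^sub>R B (\<epsilon> * t) \<omega>)
         (\<lambda>y. field_eval (lead_field \<sigma> P) y + field_eval (R \<epsilon>) y)
         ((1 / eps_pow \<epsilon> zero_half) *\<^sub>R diag_mat \<sigma>) 0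
         (\<lambda>t \<omega>. \<chi> j. x (\<epsilon> * t) \<omega> $ j / eps_pow \<epsilon> (fin_scal \<sigma> P j))
         (\<lambda>\<omega>. \<tau> \<omega> / ereal \<epsilon>)) \<and>
    (\<forall>C>0. ((\<lambda>\<epsilon>. SUP y\<in>cball 0 C. norm (field_eval (R \<epsilon>) y)) \<longlongrightarrow> 0) (at_right 0))"
proof (intro exI[of _ "remainder_field \<sigma> P"] conjI allI impI)
  let ?A = "fin_scal \<sigma> P"
  fix \<epsilon> :: real assume "0 < \<epsilon> \<and> \<epsilon> < exp (- 1)"
  then have e: "0 < \<epsilon>" "\<epsilon> < exp (- 1)"
    by auto
  have diag: "(diag_mat \<sigma> *v v) $ j = \<sigma> $ j * v $ j" for v j
    by (simp add: diag_mat_def matrix_vector_mult_def if_distrib[of "\<lambda>c. c * _"] cong: if_cong)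
  \<comment> \<open>only components with \<open>\<sigma>\<^sup>j > 0\<close> matter here, and those have scaling \<open>(1/2, 1/2)\<close>\<close>
  have "\<sigma> $ j / eps_pow \<epsilon> zero_half = sqrt \<epsilon> * \<sigma> $ j / eps_pow \<epsilon> (?A j)" for j
  proof (cases "\<sigma> $ j = 0")
    case False
    with sigma_nonneg[of j] have "?A j = half_half"
      using fin_scal_noisy[OF noise, of j] by simp
    moreover have "eps_pow \<epsilon> half_half = sqrt \<epsilon> * eps_pow \<epsilon> zero_half"
      using e loglog_pos[OF e] by (simp add: eps_pow_def scal_simps powr_half_sqrt)
    ultimately show ?thesis
      using e by simp
  qed simp
  then have noise_term: "((1 / eps_pow \<epsilon> zero_half) *\<^sub>R diag_mat \<sigma>) *v v
      = (\<chi> j. sqrt \<epsilon> * (diag_mat \<sigma> *v v) $ j / eps_pow \<epsilon> (?A j))" for v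
    by (simp add: vec_eq_iff scaleR_matrix_vector_assoc[symmetric] diag)
       (metis mult.assoc mult.commute times_divide_eq_right)
  show "solves_sde M (\<lambda>t. F (\<epsilon> * t)) (\<lambda>t \<omega>. (1 / sqrt \<epsilon>) *\<^sub>R B (\<epsilon> * t) \<omega>)
         (\<lambda>y. field_eval (lead_field \<sigma> P) y + field_eval (remainder_field \<sigma> P \<epsilon>) y)
         ((1 / eps_pow \<epsilon> zero_half) *\<^sub>R diag_mat \<sigma>) 0
         (\<lambda>t \<omega>. \<chi> j. x (\<epsilon> * t) \<omega> $ j / eps_pow \<epsilon> (?A j))
         (\<lambda>\<omega>. \<tau> \<omega> / ereal \<epsilon>)"
    using solves_sde_rescale[OF solution e(1) eval_lead_plus_remainder[OF e] noise_term]
    by (simp add: zero_vec_def)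
next
  fix C :: real assume "C > 0"
  then show "((\<lambda>\<epsilon>. SUP y\<in>cball 0 C. norm (field_eval (remainder_field \<sigma> P \<epsilon>) y)) \<longlongrightarrow> 0) (at_right 0)"
    by (rule SUP_norm_field_eval_tendsto_0[OF finite_keys keys_remainder_field
        lookup_remainder_field_tendsto_0[OF noise]])
qed

end
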